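(* Let $h,c$ be nonnegative integers and $u$ an integer with $1 \le u \le 2^h$. (i) If $u < 2^h$, then $\nu(S(c2^h+u,2^h)) \ge h-1-\nu(u)$. (ii) If moreover $c \ge 1$ and $u<2^h$, then equality $\nu(S(c2^h+u,2^h)) = h-1-\nu(u)$ holds if and only if either $u$ is even with $u \le 2^{h-1}$, or $u=1$, or $u = 1+2^{h-1}$. (iii) If $u = 2^h$, then $\nu(S(c2^h+u,2^h)) = 0$.
   Context: $S(n,k)$ denotes the Stirling number of the second kind and $\nu$ the $2$-adic valuation. *)

theory Defs
  imports "HOL-Computational_Algebra.Primes" "HOL-Combinatorics.Stirling" "HOL-Library.Extended_Real"
begin

text \<open>The 2-adic valuation with the convention that the valuation of 0 is infinite, unlike
  \<^const>\<open>multiplicity\<close>, for which \<open>multiplicity 2 0 = 0\<close>.  This matters for vanishing Stirling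
  numbers.  The codomain is \<^typ>\<open>ereal\<close> so that subtraction does not truncate.\<close>

definition nu2 :: "nat \<Rightarrow> ereal" where
  "nu2 n = (if n = 0 then \<infinity> else ereal (real (multiplicity 2 n)))"

end

theory Submission
  imports Defs "HOL-Computational_Algebra.Formal_Power_Series"
begin

text \<open>The series \<open>\<Sum>n. S(n + k, k) X^n\<close> is the reciprocal of \<open>\<Prod>i=1..k. 1 - i X\<close>.  Grouping the
  factors in blocks of four consecutive ones, a shift by \<open>2^h\<close> leaves every block unchanged modulo
  \<open>2^(h+1)\<close>, so that for \<open>h \<ge> 2\<close> the product for \<open>k = 2^(h+1)\<close> is modulo \<open>2^(h+1)\<close> the square of
  the one for \<open>k = 2^h\<close>.  Hence modulo \<open>2^h\<close> the product for \<open>k = 2^h\<close> equals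
  \<open>(1 - X^2)^(2^(h-2)) (1 + 2^(h-1) (X + e X^2))\<close> with \<open>e = 0\<close> for \<open>h = 2\<close> and \<open>e = 1\<close> for \<open>h > 2\<close>.
  Inverting it expresses the Stirling numbers by binomial coefficients \<open>K - 1 + j choose K - 1\<close> with
  \<open>K = 2^(h-2)\<close>, whose valuations follow from the parity of \<open>m choose K\<close>.\<close>

section \<open>Binomial coefficients and powers of two\<close>

text \<open>An odd binomial would be coprime to \<open>2 ^ a\<close>, and the absorption identity
  would then force \<open>2 ^ a\<close> to divide \<open>i\<close>.\<close>

lemma even_binomial_power_two:
  fixes a i :: nat
  assumes "0 < i" "i < 2 ^ a"
  shows "even (2 ^ a choose i)"
proof (rule ccontr)
  assume "odd (2 ^ a choose i)"
  then have "coprime (2 ^ a) (2 ^ a choose i)" by simp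
  moreover have "2 ^ a dvd i * (2 ^ a choose i)"
    using times_binomial_minus1_eq[OF assms(1), of "2 ^ a"] by simp
  ultimately have "2 ^ a dvd i" by (simp add: coprime_dvd_mult_left_iff)
  with assms show False by (auto dest: dvd_imp_le)
qed

text \<open>In the Vandermonde sum all inner terms are even, so only the two end terms survive
  modulo 2.\<close>

lemma odd_add_binomial_power_two:
  fixes a m :: nat
  shows "odd (2 ^ a + m choose 2 ^ a) \<longleftrightarrow> even (m choose 2 ^ a)"
proof -
  define K :: nat where "K = 2 ^ a"
  have K: "K > 0" by (simp add: K_def)
  let ?t = "\<lambda>k. (K choose k) * (m choose (K - k))"
  have "(K + m choose K) = (\<Sum>k\<le>K. ?t k)" by (simp add: vandermonde)
  also have "{..K} = insert 0 (insert K {0<..<K})" using K by auto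
  also have "sum ?t \<dots> = (m choose K) + (1 + sum ?t {0<..<K})"
    using K by (subst sum.insert; simp)
  finally have eq: "(K + m choose K) = (m choose K) + (1 + sum ?t {0<..<K})" .
  have "even (sum ?t {0<..<K})"
    by (rule dvd_sum) (auto simp: K_def even_binomial_power_two)
  then show ?thesis using eq by (simp add: K_def)
qed

text \<open>Lucas's theorem at one binary digit: adding \<open>2 ^ a\<close> to the upper index
  flips both parities.\<close>

lemma odd_binomial_power_two_iff:
  fixes a m :: nat
  shows "odd (m choose 2 ^ a) \<longleftrightarrow> odd (m div 2 ^ a)"
proof (induction m rule: less_induct)
  case (less m)
  show ?case
  proof (cases "m < 2 ^ a")
    case False
    then obtain r where r: "m = 2 ^ a + r" by (metis le_Suc_ex linorder_not_less)
    then have "odd (r choose 2 ^ a) \<longleftrightarrow> odd (r div 2 ^ a)" by (intro less) simp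
    then show ?thesis unfolding r by (simp only: odd_add_binomial_power_two) simp
  qed (simp add: binomial_eq_0)
qed

text \<open>Pascal's rule reduces this to the preceding criterion: with K = 2^a, the quotients of K
  + m and K - 1 + m by K differ exactly when K divides m.\<close>

lemma odd_binomial_power_two_minus_one_iff:
  fixes a m :: nat
  shows "odd (2 ^ a - 1 + m choose (2 ^ a - 1)) \<longleftrightarrow> 2 ^ a dvd m"
proof (cases m)
  case (Suc r)
  define K :: nat where "K = 2 ^ a"
  have K: "K > 0" by (simp add: K_def)
  have "(K + m choose K) = (K - 1 + m choose (K - 1)) + (K - 1 + m choose K)"
    using K by (cases K) auto
  moreover have "odd (K + m choose K) \<longleftrightarrow> odd ((K + m) div K)"
    unfolding K_def by (rule odd_binomial_power_two_iff)
  moreover have "odd (K - 1 + m choose K) \<longleftrightarrow> odd ((K - 1 + m) div K)"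
    unfolding K_def by (rule odd_binomial_power_two_iff)
  moreover have "(K + m) div K = Suc (m div K)" using K by simp
  moreover have "K - 1 + m = K + r" using K Suc by simp
  then have "(K - 1 + m) div K = Suc (r div K)" using K by simp
  moreover have "m div K = (if K dvd m then Suc (r div K) else r div K)"
    unfolding Suc div_Suc by (simp add: mod_eq_0_iff_dvd)
  ultimately show ?thesis by (auto simp: K_def split: if_splits)
qed simp

lemma times_binomial_minus_one:
  fixes K j :: nat
  assumes "K > 0"
  shows "j * (K - 1 + j choose (K - 1)) = K * (K - 1 + j choose K)"
  using binomial_absorb_comp[of "K - 1 + j" "K - 1"] assms
        times_binomial_minus1_eq[OF assms, of "K - 1 + j"]
  by (cases K) auto

text \<open>Trading the lower index \<open>2 ^ m - 1\<close> for \<open>2 ^ m\<close> gives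
  \<open>i * ?b = 2 ^ (m - w) * ?C\<close> with \<open>i\<close> odd, so a further factor 2 in
  \<open>?b\<close> depends on the parity of \<open>?C\<close>.\<close>

lemma power_two_dvd_binomial:
  fixes m w i :: nat
  assumes "odd i" "w \<le> m"
  shows "2 ^ (m - w) dvd (2 ^ m - 1 + 2 ^ w * i choose (2 ^ m - 1))" (is "_ dvd ?b")
    and "2 ^ (m - w + 1) dvd (2 ^ m - 1 + 2 ^ w * i choose (2 ^ m - 1)) \<longleftrightarrow>
           odd ((2 ^ w * i - 1) div 2 ^ m)"
proof -
  let ?C = "2 ^ m - 1 + 2 ^ w * i choose 2 ^ m"
  have "2 ^ w * (i * ?b) = 2 ^ m * ?C"
    using times_binomial_minus_one[of "2 ^ m" "2 ^ w * i"] by (simp add: mult.assoc)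
  moreover have "2 ^ m * ?C = 2 ^ w * (2 ^ (m - w) * ?C)"
    using assms by (simp only: mult.assoc[symmetric] power_add[symmetric]) simp
  ultimately have "2 ^ w * (i * ?b) = 2 ^ w * (2 ^ (m - w) * ?C)" by (rule trans)
  then have eq: "i * ?b = 2 ^ (m - w) * ?C" by (simp only: mult_cancel1) simp
  have cop: "coprime (2 ^ k) i" for k using assms by simp
  have dvd: "2 ^ k dvd ?b \<longleftrightarrow> 2 ^ k dvd 2 ^ (m - w) * ?C" for k
    unfolding eq[symmetric] using cop[of k] by (simp add: coprime_dvd_mult_right_iff)
  show "2 ^ (m - w) dvd ?b" unfolding dvd by (rule dvd_triv_left)
  have "2 ^ w * i > 0" using assms by (auto intro: Nat.gr0I)
  then have "2 ^ m - 1 + 2 ^ w * i = 2 ^ m + (2 ^ w * i - 1)" by simp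
  then have "odd ((2 ^ m - 1 + 2 ^ w * i) div 2 ^ m) \<longleftrightarrow> even ((2 ^ w * i - 1) div 2 ^ m)"
    by simp
  moreover have "2 ^ (m - w + 1) dvd ?b \<longleftrightarrow> even ?C" unfolding dvd by simp
  ultimately show "2 ^ (m - w + 1) dvd ?b \<longleftrightarrow> odd ((2 ^ w * i - 1) div 2 ^ m)"
    using odd_binomial_power_two_iff by blast
qed

section \<open>Generating functions\<close>

unbundle fps_syntax

definition stirling_fps :: "nat \<Rightarrow> int fps" where
  "stirling_fps k = Abs_fps (\<lambda>n. int (Stirling (n + k) k))"

definition stirling_denom_fps :: "nat \<Rightarrow> int fps" where
  "stirling_denom_fps k = (\<Prod>i<k. 1 - of_nat (Suc i) * fps_X)"

lemma fps_of_nat_times_X_times_nth: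
  fixes F :: "int fps"
  shows "(of_nat c * fps_X * F) $ n = (if n = 0 then 0 else int c * F $ (n - 1))"
  by (simp add: fps_of_nat[symmetric] mult.assoc)

text \<open>The recurrence S(n+1,k+1) = (k+1) S(n,k+1) + S(n,k) in terms of generating
  functions.\<close>

lemma stirling_fps_Suc: "(1 - of_nat (Suc k) * fps_X) * stirling_fps (Suc k) = stirling_fps k"
proof (rule fps_ext)
  fix n
  show "((1 - of_nat (Suc k) * fps_X) * stirling_fps (Suc k)) $ n = stirling_fps k $ n"
    unfolding left_diff_distrib fps_sub_nth fps_of_nat_times_X_times_nth
    by (cases n) (simp_all add: stirling_fps_def algebra_simps)
qed

lemma stirling_denom_fps_times_stirling_fps: "stirling_denom_fps k * stirling_fps k = 1"
proof (induction k)
  case 0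
  show ?case
  proof (rule fps_ext)
    fix n show "(stirling_denom_fps 0 * stirling_fps 0) $ n = 1 $ n"
      by (cases n) (simp_all add: stirling_denom_fps_def stirling_fps_def)
  qed
next
  case (Suc k)
  have "stirling_denom_fps (Suc k) * stirling_fps (Suc k) =
      stirling_denom_fps k * ((1 - of_nat (Suc k) * fps_X) * stirling_fps (Suc k))"
    by (simp add: stirling_denom_fps_def mult.assoc del: of_nat_Suc)
  then show ?case using Suc by (simp add: stirling_fps_Suc del: of_nat_Suc)
qed

text \<open>The expansion of (1 - X^2)^(-(k+1)).\<close>

definition even_binomial_fps :: "nat \<Rightarrow> int fps" where
  "even_binomial_fps k = Abs_fps (\<lambda>n. if even n then int (k + n div 2 choose k) else 0)"

lemma fps_one_minus_X2_times_nth: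
  fixes F :: "int fps"
  shows "((1 - fps_X ^ 2) * F) $ n = F $ n - (if n < 2 then 0 else F $ (n - 2))"
  by (simp add: left_diff_distrib fps_X_power_mult_nth)

text \<open>Pascal's rule cancels one factor 1 - X^2 at a time.\<close>

lemma even_binomial_fps_power: "(1 - fps_X ^ 2) ^ Suc k * even_binomial_fps k = 1"
proof (induction k)
  case 0
  show ?case
    by (rule fps_ext) (auto simp: fps_one_minus_X2_times_nth even_binomial_fps_def less_2_cases_iff)
next
  case (Suc k)
  have "(1 - fps_X ^ 2) * even_binomial_fps (Suc k) = even_binomial_fps k"
  proof (rule fps_ext)
    fix n
    show "((1 - fps_X ^ 2) * even_binomial_fps (Suc k)) $ n = even_binomial_fps k $ n"
    proof (cases "n < 2")
      case True
      then show ?thesis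
        by (auto simp: fps_one_minus_X2_times_nth even_binomial_fps_def less_2_cases_iff)
    next
      case False
      then obtain r where "n = r + 2" by (metis le_add_diff_inverse2 linorder_not_less)
      then show ?thesis by (simp add: fps_one_minus_X2_times_nth even_binomial_fps_def)
    qed
  qed
  then show ?case
    by (simp only: power_Suc2[of _ "Suc k"] mult.assoc Suc)
qed

section \<open>The product modulo powers of two\<close>

lemma dvd_mult_diff:
  fixes a b c d e :: "'a::comm_ring_1"
  assumes "d dvd a - b" "d dvd c - e"
  shows "d dvd a * c - b * e"
proof -
  have "a * c - b * e = (a - b) * c + b * (c - e)" by (simp add: algebra_simps)
  then show ?thesis using assms by simp
qed

lemma dvd_prod_diff:
  fixes f g :: "nat \<Rightarrow> 'a::comm_ring_1"
  assumes "\<And>i. d dvd f i - g i"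
  shows "d dvd (\<Prod>i<n. f i) - (\<Prod>i<n. g i)"
proof (induction n)
  case (Suc n)
  then show ?case by (simp add: dvd_mult_diff assms)
qed simp

definition block_fps :: "nat \<Rightarrow> int fps" where
  "block_fps m = (\<Prod>i<4. 1 - of_nat (4 * m + i + 1) * fps_X)"

lemma stirling_denom_fps_blocks: "stirling_denom_fps (4 * n) = (\<Prod>m<n. block_fps m)"
proof (induction n)
  case (Suc n)
  have "stirling_denom_fps (4 * Suc n) = stirling_denom_fps (4 * n) * block_fps n"
    by (simp add: stirling_denom_fps_def block_fps_def eval_nat_numeral mult.assoc)
  then show ?case using Suc by simp
qed (simp add: stirling_denom_fps_def)

text \<open>The factors with indices \<open>i\<close> and \<open>i + 2\<close> have a sum divisible by 2, so shifting both
  by \<open>4 * t\<close> changes their product by a multiple of \<open>8 * t\<close>.\<close>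
lemma pair_shift:
  fixes x i t :: "'a::comm_ring_1"
  shows "8 * t dvd (1 - (i + 4 * t) * x) * (1 - (i + 2 + 4 * t) * x) -
      (1 - i * x) * (1 - (i + 2) * x)"
proof
  show "(1 - (i + 4 * t) * x) * (1 - (i + 2 + 4 * t) * x) - (1 - i * x) * (1 - (i + 2) * x) =
      8 * t * (2 * t * x ^ 2 - x * (1 - i * x - x))"
    by (simp add: algebra_simps power2_eq_square)
qed

text \<open>The four factors form two pairs with indices two apart, and \<open>pair_shift\<close>
  applies to each pair.\<close>

lemma block_fps_shift: "8 * of_nat t dvd block_fps (m + t) - block_fps m"
proof -
  define x :: "int fps" where "x = fps_X"
  define M T :: "int fps" where "M = of_nat m" and "T = of_nat t"
  let ?p = "\<lambda>i. (1 - i * x) * (1 - (i + 2) * x)"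
  let ?q = "\<lambda>i. (1 - (i + 4 * T) * x) * (1 - (i + 2 + 4 * T) * x)"
  have "block_fps m = ?p (4 * M + 1) * ?p (4 * M + 2)"
    by (simp add: block_fps_def eval_nat_numeral M_def x_def) (simp add: algebra_simps)
  moreover have "block_fps (m + t) = ?q (4 * M + 1) * ?q (4 * M + 2)"
    by (simp add: block_fps_def eval_nat_numeral M_def T_def x_def) (simp add: algebra_simps)
  ultimately show ?thesis
    by (simp only: T_def[symmetric]) (intro dvd_mult_diff pair_shift)
qed

text \<open>The larger product has \<open>2 * 2 ^ m\<close> blocks; its second half is the first
  shifted by \<open>2 ^ m\<close> blocks, which changes nothing modulo
  \<open>8 * 2 ^ m\<close>.\<close>

lemma stirling_denom_fps_double: "2 ^ (m + 3) dvd stirling_denom_fps (2 ^ (m + 3)) - stirling_denom_fps (2 ^ (m + 2)) ^ 2"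
proof -
  define T :: nat where "T = 2 ^ m"
  have split: "(\<Prod>i<T + k. block_fps i) = (\<Prod>i<T. block_fps i) * (\<Prod>i<k. block_fps (i + T))" for k
    by (induction k) (simp_all add: mult.assoc add.commute)
  have "2 ^ (m + 3) = (8 * of_nat T :: int fps)" by (simp add: T_def power_add)
  then have "2 ^ (m + 3) dvd (\<Prod>i<T. block_fps (i + T)) - (\<Prod>i<T. block_fps i)"
    using block_fps_shift[of T] by (auto intro: dvd_prod_diff)
  then have "2 ^ (m + 3) dvd (\<Prod>i<T + T. block_fps i) - (\<Prod>i<T. block_fps i) ^ 2"
    unfolding split power2_eq_square by (intro dvd_mult_diff) simp_all
  moreover have "2 ^ (m + 3) = 4 * (T + T)" "2 ^ (m + 2) = 4 * T"
    by (simp_all add: T_def power_add)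
  ultimately show ?thesis by (simp only: stirling_denom_fps_blocks)
qed

text \<open>The term X + e X^2, with \<open>m\<close> standing for h - 2.\<close>

definition err_fps :: "nat \<Rightarrow> int fps" where
  "err_fps m = (if m = 0 then fps_X else fps_X + fps_X ^ 2)"

lemma stirling_denom_fps_base: "4 dvd stirling_denom_fps 4 - (1 - fps_X ^ 2) * (1 + 2 * fps_X)"
proof
  show "stirling_denom_fps 4 - (1 - fps_X ^ 2) * (1 + 2 * fps_X) =
      4 * (6 * fps_X ^ 4 - 12 * fps_X ^ 3 + 9 * fps_X ^ 2 - 3 * fps_X)"
    by (simp add: stirling_denom_fps_def eval_nat_numeral) (simp add: algebra_simps)
qed

text \<open>Since a + b = (a - b) + 2 b is even, squaring gains a factor 2 in the modulus.\<close>

lemma dvd_square_diff: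
  fixes a b d :: "'a::comm_ring_1"
  assumes "d dvd a - b" "2 dvd d"
  shows "2 * d dvd a ^ 2 - b ^ 2"
proof -
  have "2 dvd (a - b) + 2 * b" using assms by (meson dvd_add dvd_trans dvd_triv_left)
  then have "2 * d dvd ((a - b) + 2 * b) * (a - b)" using assms(1) by (rule mult_dvd_mono)
  then show ?thesis by (simp add: algebra_simps power2_eq_square)
qed

text \<open>Squaring the congruence for \<open>m\<close> gains one power of 2, and the doubling
  congruence replaces the squared product by the next one.\<close>

lemma stirling_denom_fps_mod:
  "2 ^ (m + 2) dvd
     stirling_denom_fps (2 ^ (m + 2)) - (1 - fps_X ^ 2) ^ 2 ^ m * (1 + 2 ^ (m + 1) * err_fps m)"
proof (induction m)
  case 0
  show ?case using stirling_denom_fps_base by (simp add: err_fps_def)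
next
  case (Suc m)
  define E where "E = (1 - fps_X ^ 2 :: int fps) ^ 2 ^ m"
  define y where "y = 2 ^ (m + 1) * err_fps m"
  define d :: "int fps" where "d = 2 ^ (m + 3)"
  have d: "d = 2 * 2 ^ (m + 2)" by (simp add: d_def eval_nat_numeral)
  have E2: "(1 - fps_X ^ 2) ^ 2 ^ Suc m = E ^ 2" by (simp add: E_def power_even_eq)
  have "d dvd stirling_denom_fps (2 ^ (m + 2)) ^ 2 - (E * (1 + y)) ^ 2"
    unfolding d E_def y_def using Suc by (intro dvd_square_diff) (simp, rule dvd_power, simp)
  moreover have "d dvd stirling_denom_fps (2 ^ (m + 3)) - stirling_denom_fps (2 ^ (m + 2)) ^ 2"
    unfolding d_def by (rule stirling_denom_fps_double)
  moreover have "d dvd (E * (1 + y)) ^ 2 - E ^ 2 * (1 + 2 ^ (m + 2) * err_fps (Suc m))"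
  proof -
    have "d dvd (1 + y) ^ 2 - (1 + 2 ^ (m + 2) * err_fps (Suc m))"
    \<comment> \<open>For \<open>m = 0\<close> the square of y = 2 X is 4 X^2, which survives modulo
      8 and becomes the X^2 in \<open>err_fps 1\<close>; for larger \<open>m\<close> the square of
      \<open>y\<close> vanishes modulo \<open>d\<close>.\<close>
    proof (cases m)
      case 0
      then show ?thesis by (simp add: y_def err_fps_def algebra_simps power2_eq_square)
    next
      case (Suc k)
      then have "(1 + y) ^ 2 - (1 + 2 ^ (m + 2) * err_fps (Suc m)) = d * (2 ^ k * err_fps m ^ 2)"
        by (simp add: y_def d_def err_fps_def algebra_simps power2_eq_square power_add)
      then show ?thesis by simp
    qed
    then show ?thesis
      by (simp only: power_mult_distrib right_diff_distrib[symmetric] dvd_mult)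
  qed
  ultimately have "d dvd (stirling_denom_fps (2 ^ (m + 3)) - stirling_denom_fps (2 ^ (m + 2)) ^ 2) +
      (stirling_denom_fps (2 ^ (m + 2)) ^ 2 - (E * (1 + y)) ^ 2) +
      ((E * (1 + y)) ^ 2 - E ^ 2 * (1 + 2 ^ (m + 2) * err_fps (Suc m)))"
    by (intro dvd_add)
  moreover have "Suc m + 2 = m + 3" "Suc m + 1 = m + 2" by simp_all
  ultimately show ?case unfolding E2 by (simp only: d_def diff_add_cancel) simp
qed

lemma stirling_fps_mod:
  "2 ^ (m + 2) dvd
     stirling_fps (2 ^ (m + 2)) - even_binomial_fps (2 ^ m - 1) * (1 - 2 ^ (m + 1) * err_fps m)"
proof -
  define P S where "P = stirling_denom_fps (2 ^ (m + 2))" and "S = stirling_fps (2 ^ (m + 2))"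
  define B where "B = even_binomial_fps (2 ^ m - 1)"
  define E where "E = (1 - fps_X ^ 2 :: int fps) ^ 2 ^ m"
  define y where "y = 2 ^ (m + 1) * err_fps m"
  have PS: "P * S = 1" by (simp add: P_def S_def stirling_denom_fps_times_stirling_fps)
  have EB: "E * B = 1"
    using even_binomial_fps_power[of "2 ^ m - 1"] by (simp add: E_def B_def)
  have "2 ^ (m + 2) dvd P - E * (1 + y)"
    unfolding P_def E_def y_def by (rule stirling_denom_fps_mod)
  \<comment> \<open>Modulo \<open>y ^ 2\<close> the inverse of \<open>1 + y\<close> is
    \<open>1 - y\<close>; the multiplier also completes \<open>P * S\<close> and
    \<open>E * B\<close>, both equal to 1.\<close>
  then have "2 ^ (m + 2) dvd S * (B * (1 - y)) * (P - E * (1 + y))" by (rule dvd_mult)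
  also have "S * (B * (1 - y)) * (P - E * (1 + y)) =
      B * (1 - y) * (P * S) - S * (E * B) * (1 - y ^ 2)"
    by (simp add: algebra_simps power2_eq_square)
  finally have "2 ^ (m + 2) dvd B * (1 - y) - S * (1 - y ^ 2)" by (simp add: PS EB)
  moreover have "y ^ 2 = 2 ^ (m + 2) * (2 ^ m * err_fps m ^ 2)"
    by (simp add: y_def power_mult_distrib power_add power2_eq_square mult_ac)
  then have "2 ^ (m + 2) dvd S * y ^ 2" by simp
  ultimately have "2 ^ (m + 2) dvd S * y ^ 2 - (B * (1 - y) - S * (1 - y ^ 2))"
    by (rule dvd_diff[rotated])
  then show ?thesis by (simp add: algebra_simps S_def B_def y_def)
qed

section \<open>Congruences for single Stirling numbers, read off from coefficients\<close>

lemma fps_power_two_times_nth: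
  fixes F :: "int fps"
  shows "(2 ^ k * F) $ n = 2 ^ k * F $ n"
  by (simp add: numeral_fps_const fps_const_power)

lemma fps_power_two_dvd_nth:
  fixes F :: "int fps"
  assumes "2 ^ k dvd F"
  shows "2 ^ k dvd F $ n"
  using assms by (auto simp: fps_power_two_times_nth elim!: dvdE)

text \<open>At odd exponents the even binomial series drops out, and only the X in
  \<open>err_fps\<close> contributes.\<close>

lemma stirling_mod_odd:
  fixes m j :: nat
  shows "2 ^ (m + 2) dvd Stirling (2 * j + 1 + 2 ^ (m + 2)) (2 ^ (m + 2)) +
     2 ^ (m + 1) * (2 ^ m - 1 + j choose (2 ^ m - 1))"
proof -
  define B where "B = even_binomial_fps (2 ^ m - 1)"
  let ?b = "2 ^ m - 1 + j choose (2 ^ m - 1)"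
  have "(B * err_fps m) $ (2 * j + 1) = int ?b"
    by (auto simp: err_fps_def distrib_left fps_X_power_mult_right_nth B_def even_binomial_fps_def)
  moreover have "stirling_fps (2 ^ (m + 2)) - B * (1 - 2 ^ (m + 1) * err_fps m) =
      stirling_fps (2 ^ (m + 2)) - B + 2 ^ (m + 1) * (B * err_fps m)"
    by (simp add: algebra_simps)
  moreover have "B $ (2 * j + 1) = 0" by (simp add: B_def even_binomial_fps_def)
  ultimately have "2 ^ (m + 2) dvd int (Stirling (2 * j + 1 + 2 ^ (m + 2)) (2 ^ (m + 2))) +
     2 ^ (m + 1) * int ?b"
    using fps_power_two_dvd_nth[OF stirling_fps_mod[of m], of "2 * j + 1"]
    by (simp only: B_def[symmetric] fps_add_nth fps_sub_nth fps_power_two_times_nth)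
       (simp add: stirling_fps_def)
  then have "int (2 ^ (m + 2)) dvd int (Stirling (2 * j + 1 + 2 ^ (m + 2)) (2 ^ (m + 2)) +
     2 ^ (m + 1) * ?b)"
    by simp
  then show ?thesis by (simp only: int_dvd_int_iff)
qed

text \<open>With the modulus one power lower than in \<open>stirling_fps_mod\<close>, the whole
  \<open>err_fps\<close> term vanishes.\<close>

lemma stirling_mod_even:
  fixes m j :: nat
  shows "2 ^ (m + 1) dvd int (Stirling (2 * j + 2 ^ (m + 2)) (2 ^ (m + 2))) -
     int (2 ^ m - 1 + j choose (2 ^ m - 1))"
proof -
  define B where "B = even_binomial_fps (2 ^ m - 1)"
  have eq: "stirling_fps (2 ^ (m + 2)) - B * (1 - 2 ^ (m + 1) * err_fps m) =
      stirling_fps (2 ^ (m + 2)) - B + 2 ^ (m + 1) * (B * err_fps m)"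
    by (simp add: algebra_simps)
  have "2 ^ (m + 2) dvd stirling_fps (2 ^ (m + 2)) - B + 2 ^ (m + 1) * (B * err_fps m)"
    using stirling_fps_mod[of m] unfolding B_def[symmetric] eq .
  then have "2 ^ (m + 1) dvd stirling_fps (2 ^ (m + 2)) - B + 2 ^ (m + 1) * (B * err_fps m)"
    by (rule power_le_dvd) simp
  then have "2 ^ (m + 1) dvd stirling_fps (2 ^ (m + 2)) - B"
    by (simp add: dvd_add_left_iff)
  from fps_power_two_dvd_nth[OF this, of "2 * j"] show ?thesis
    by (simp add: stirling_fps_def B_def even_binomial_fps_def)
qed

section \<open>Valuations\<close>

text \<open>Here h = m + 2, and \<open>Suc d\<close> supplies the index shift built into
  \<open>stirling_fps\<close>. The parity of \<open>u\<close> decides which coefficient congruence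
  applies.\<close>

lemma stirling_power_two_dvd:
  fixes d m u :: nat
  assumes "0 < u" "u < 2 ^ (m + 2)"
  defines "S \<equiv> Stirling (Suc d * 2 ^ (m + 2) + u) (2 ^ (m + 2))"
    and "v \<equiv> multiplicity 2 u"
  shows "2 ^ (m + 1 - v) dvd S"
    and "2 ^ (m + 2 - v) dvd S \<longleftrightarrow>
      \<not> (even u \<and> u \<le> 2 ^ (m + 1) \<or> u = 1 \<or> u = 1 + 2 ^ (m + 1))"
proof -
  have "2 ^ (m + 1 - v) dvd S \<and> (2 ^ (m + 2 - v) dvd S \<longleftrightarrow>
      \<not> (even u \<and> u \<le> 2 ^ (m + 1) \<or> u = 1 \<or> u = 1 + 2 ^ (m + 1)))"
  proof (cases "even u")
    case False
    then obtain i where u: "u = 2 * i + 1" by (elim oddE)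
    define j where "j = d * 2 ^ (m + 1) + i"
    let ?b = "2 ^ m - 1 + j choose (2 ^ m - 1)"
    have v: "v = 0" using False by (simp add: v_def not_dvd_imp_multiplicity_0)
    have "Suc d * 2 ^ (m + 2) + u = 2 * j + 1 + 2 ^ (m + 2)" by (simp add: u j_def)
    then have dvd: "2 ^ (m + 2) dvd S + 2 ^ (m + 1) * ?b"
      unfolding S_def using stirling_mod_odd by metis
    then have "2 ^ (m + 1) dvd S + 2 ^ (m + 1) * ?b" by (rule power_le_dvd) simp
    then have "2 ^ (m + 1) dvd S" by (simp add: dvd_add_left_iff)
    moreover have "2 ^ (m + 2) dvd S \<longleftrightarrow> 2 ^ (m + 2) dvd 2 ^ (m + 1) * ?b"
      using dvd dvd_add_right_iff dvd_add_left_iff by blast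
    then have "2 ^ (m + 2) dvd S \<longleftrightarrow> even ?b" by simp
    moreover have "odd ?b \<longleftrightarrow> 2 ^ m dvd i"
      by (subst odd_binomial_power_two_minus_one_iff) (simp add: j_def dvd_add_right_iff)
    \<comment> \<open>The bound on \<open>u\<close> gives i < 2^(m+1), leaving two multiples of 2^m;
      they yield the exceptional values 1 and 1 + 2^(m+1) of \<open>u\<close>.\<close>
    moreover have "2 ^ m dvd i \<longleftrightarrow> i = 0 \<or> i = 2 ^ m"
    proof
      assume "2 ^ m dvd i"
      then obtain q where q: "i = 2 ^ m * q" ..
      have "u < 2 * (2 ^ m * 2)" using assms(2) by simp
      then have "2 ^ m * q < 2 ^ m * 2" unfolding u q by linarith
      then have "q < 2" by (simp only: mult_less_cancel1)
      then show "i = 0 \<or> i = 2 ^ m" using q by (auto simp: less_2_cases_iff)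
    qed auto
    moreover have "even u \<and> u \<le> 2 ^ (m + 1) \<or> u = 1 \<or> u = 1 + 2 ^ (m + 1) \<longleftrightarrow>
        i = 0 \<or> i = 2 ^ m"
      using u by auto
    ultimately show ?thesis unfolding v diff_zero by blast
  next
    case True
    then obtain r where r: "u = 2 * r" by (elim evenE)
    with assms have rpos: "r > 0" by simp
    then obtain w i where wi: "r = 2 ^ w * i" "odd i"
      using multiplicity_decompose'[of r 2]
      by (metis less_irrefl odd_one)
    have pos: "i > 0" using wi by (auto intro: Nat.gr0I)
    have "2 ^ w * 1 \<le> r" unfolding wi using pos by (intro mult_le_mono) auto
    then have "(2::nat) ^ w < 2 ^ (m + 1)" using assms r by simp
    then have "w < m + 1" by (rule power_less_imp_less_exp[rotated]) simp
    then have wm: "w \<le> m" by simp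
    have v: "v = w + 1"
      unfolding v_def using wi r by (intro multiplicity_eqI) auto
    \<comment> \<open>As w is at most m, adding the multiple d 2^(m+1) to \<open>r\<close> preserves
      its exact power \<open>2 ^ w\<close>; \<open>i'\<close> is the new odd cofactor.\<close>
    define i' where "i' = d * 2 ^ (m + 1 - w) + i"
    define j where "j = 2 ^ w * i'"
    let ?b = "2 ^ m - 1 + j choose (2 ^ m - 1)"
    have "(2::nat) ^ (m + 1) = 2 ^ w * 2 ^ (m + 1 - w)" using wm by (simp flip: power_add)
    then have j: "j = d * 2 ^ (m + 1) + r" by (simp add: j_def i'_def wi algebra_simps)
    have "odd i'" using wm wi by (simp add: i'_def)
    have b: "2 ^ (m - w) dvd ?b" "2 ^ (m - w + 1) dvd ?b \<longleftrightarrow> odd ((j - 1) div 2 ^ m)"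
      unfolding j_def using power_two_dvd_binomial[OF \<open>odd i'\<close> wm] by blast+
    have "Suc d * 2 ^ (m + 2) + u = 2 * j + 2 ^ (m + 2)" by (simp add: r j)
    then have "2 ^ (m + 1) dvd int S - int ?b"
      unfolding S_def using stirling_mod_even by metis
    \<comment> \<open>The exponents of interest, m - w and m - w + 1, are at most m + 1, so the
      congruence decides both.\<close>
    then have "2 ^ k dvd int S \<longleftrightarrow> 2 ^ k dvd int ?b" if "k \<le> m + 1" for k
      using dvd_add_right_iff[of "2 ^ k" "int S - int ?b" "int ?b"] power_le_dvd[OF _ that]
      by (simp only: diff_add_cancel) blast
    then have "int (2 ^ k) dvd int S \<longleftrightarrow> int (2 ^ k) dvd int ?b" if "k \<le> m + 1" for k
      using that by simp
    then have S: "2 ^ k dvd S \<longleftrightarrow> 2 ^ k dvd ?b" if "k \<le> m + 1" for k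
      using that unfolding int_dvd_int_iff by blast
    have "j - 1 = 2 ^ m * (2 * d) + (r - 1)" using rpos by (simp add: j mult_ac)
    then have "odd ((j - 1) div 2 ^ m) \<longleftrightarrow> odd ((r - 1) div 2 ^ m)" by simp
    \<comment> \<open>Since 0 < r < 2^(m+1), the quotient is 0 or 1.\<close>
    also have "\<dots> \<longleftrightarrow> \<not> r \<le> 2 ^ m"
    proof (cases "r \<le> 2 ^ m")
      case False
      then obtain t where t: "r = 2 ^ m + Suc t"
        by (metis less_imp_Suc_add add_Suc_right linorder_not_less)
      then have "t < 2 ^ m" using assms r by simp
      then show ?thesis using t by simp
    qed (use rpos in simp)
    finally show ?thesis using b v wm r True S[of "m - w"] S[of "m - w + 1"]
      by (auto simp: Suc_diff_le)
  qed
  then show "2 ^ (m + 1 - v) dvd S" "2 ^ (m + 2 - v) dvd S \<longleftrightarrow>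
      \<not> (even u \<and> u \<le> 2 ^ (m + 1) \<or> u = 1 \<or> u = 1 + 2 ^ (m + 1))" by blast+
qed

section \<open>Translation to \<open>nu2\<close>, the odd cases, and assembly\<close>

lemma nu2_ge_iff: "ereal (real k) \<le> nu2 n \<longleftrightarrow> 2 ^ k dvd n"
  \<comment> \<open>For \<open>n = 0\<close> both sides hold, the valuation being infinite.\<close>
  by (auto simp: nu2_def power_dvd_iff_le_multiplicity)

lemma nu2_eq_iff: "nu2 n = ereal (real k) \<longleftrightarrow> 2 ^ k dvd n \<and> \<not> 2 ^ Suc k dvd n"
  by (auto simp: nu2_def power_dvd_iff_le_multiplicity simp del: power_Suc)

text \<open>S(n+1,2) = 2^n - 1.\<close>

lemma odd_stirling_two: "n > 0 \<Longrightarrow> odd (Stirling (Suc n) 2)"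
  using Stirling_2[of n] by (simp only: numeral_2_eq_2[symmetric]) simp

text \<open>For h = m + 2 the even congruence transfers the parity of a binomial that is odd because
  2^m divides \<open>?j\<close>; the smaller h lie outside the block argument.\<close>

lemma odd_stirling_power_two: "odd (Stirling (c * 2 ^ h + 2 ^ h) (2 ^ h))"
proof -
  consider "h = 0" | "h = 1" | m where "h = m + 2"
    by (metis One_nat_def add_2_eq_Suc' not0_implies_Suc)
  then show ?thesis
  proof cases
    case 1
    then show ?thesis using Stirling_1[of c] by (simp del: Stirling.simps)
  next
    case 2
    then show ?thesis using odd_stirling_two[of "c * 2 + 1"] by (simp del: Stirling.simps)
  next
    case 3
    let ?j = "c * 2 ^ (m + 1)"
    let ?b = "2 ^ m - 1 + ?j choose (2 ^ m - 1)"
    have "2 ^ (m + 1) dvd int (Stirling (c * 2 ^ h + 2 ^ h) (2 ^ h)) - int ?b"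
      using stirling_mod_even[of m ?j] by (simp add: 3 mult_ac del: Stirling.simps)
    then have "even (int (Stirling (c * 2 ^ h + 2 ^ h) (2 ^ h)) - int ?b)"
      by (rule dvd_trans[rotated]) simp
    moreover have "odd ?b" by (subst odd_binomial_power_two_minus_one_iff) simp
    ultimately show ?thesis by (simp del: Stirling.simps)
  qed
qed

theorem theorem2p4:
  fixes h c u :: nat
  assumes "1 \<le> u" and "u \<le> 2 ^ h"
  shows "(u < 2 ^ h \<longrightarrow>
            nu2 (Stirling (c * 2 ^ h + u) (2 ^ h)) \<ge> ereal (real h) - 1 - nu2 u) \<and>
         (c \<ge> 1 \<and> u < 2 ^ h \<longrightarrow>
            (nu2 (Stirling (c * 2 ^ h + u) (2 ^ h)) = ereal (real h) - 1 - nu2 u \<longleftrightarrow>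
              (even u \<and> u \<le> 2 ^ (h - 1)) \<or> u = 1 \<or> u = 1 + 2 ^ (h - 1))) \<and>
         (u = 2 ^ h \<longrightarrow>
            nu2 (Stirling (c * 2 ^ h + u) (2 ^ h)) = 0)"
proof (intro conjI impI)
  let ?S = "Stirling (c * 2 ^ h + u) (2 ^ h)"
  let ?Q = "(even u \<and> u \<le> 2 ^ (h - 1)) \<or> u = 1 \<or> u = 1 + 2 ^ (h - 1)"
  define v where "v = multiplicity 2 u"
  have rhs: "ereal (real h) - 1 - nu2 u = ereal (real (h - 1 - v))"
    and main: "c \<ge> 1 \<Longrightarrow> 2 ^ (h - 1 - v) dvd ?S \<and> (2 ^ Suc (h - 1 - v) dvd ?S \<longleftrightarrow> \<not> ?Q)"
    if lt: "u < 2 ^ h"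
  proof -
    have "2 ^ v dvd u" by (simp add: v_def multiplicity_dvd)
    then have "2 ^ v \<le> u" using assms by (intro dvd_imp_le) auto
    then have "(2::nat) ^ v < 2 ^ h" using lt by (rule le_less_trans)
    \<comment> \<open>This makes the truncated \<open>h - 1 - v\<close> agree with the subtraction
      in \<open>ereal\<close>, and it excludes h = 0.\<close>
    then have vh: "v < h" by (simp add: power_strict_increasing_iff)
    then show "ereal (real h) - 1 - nu2 u = ereal (real (h - 1 - v))"
      using assms by (simp add: nu2_def v_def one_ereal_def of_nat_diff)
    assume "c \<ge> 1"
    then obtain d where d: "c = Suc d" by (cases c) auto
    consider "h = 1" | m where "h = m + 2"
      using vh by (metis One_nat_def Suc_eq_plus1 add_2_eq_Suc' less_zeroE old.nat.exhaust)
    then show "2 ^ (h - 1 - v) dvd ?S \<and> (2 ^ Suc (h - 1 - v) dvd ?S \<longleftrightarrow> \<not> ?Q)"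
    proof cases
      case 1
      with lt assms have u: "u = 1" by simp
      then have "v = 0" by (simp add: v_def)
      moreover have "odd ?S"
        using odd_stirling_two[of "2 * c"] 1 u \<open>c \<ge> 1\<close> by (simp add: mult_ac del: Stirling.simps)
      ultimately show ?thesis using 1 u by simp
    next
      case 2
      have "0 < u" "u < 2 ^ (m + 2)" using assms lt 2 by auto
      from stirling_power_two_dvd[OF this, of d] show ?thesis
        using vh unfolding d 2 v_def by (simp add: Suc_diff_le del: Stirling.simps power_Suc)
    qed
  qed
  show "nu2 ?S \<ge> ereal (real h) - 1 - nu2 u" if "u < 2 ^ h"
  proof (cases "c = 0")
    \<comment> \<open>Here S(u,2^h) = 0 because u < 2^h, so its valuation is infinite.\<close>
    case True
    then show ?thesis using that by (simp add: nu2_def)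
  next
    case False
    then show ?thesis using main[OF that] by (simp add: rhs[OF that] nu2_ge_iff)
  qed
  show "nu2 ?S = ereal (real h) - 1 - nu2 u \<longleftrightarrow> ?Q" if "c \<ge> 1 \<and> u < 2 ^ h"
    using main that unfolding rhs[OF conjunct2[OF that]] nu2_eq_iff by blast
  show "nu2 ?S = 0" if "u = 2 ^ h"
    using odd_stirling_power_two[of c h] nu2_eq_iff[of ?S 0] that by (simp add: zero_ereal_def)
qed

end
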